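(* Consider the positive impulsive system with constant matrices $$\dot x(t)=Ax(t)+E_cw_c(t),\ t\in(t_k,t_{k+1}],\ k\ge0;\qquad x(t_k^+)=Jx(t_k)+E_dw_d(k),\ k\ge1;$$ $$z_c(t)=C_cx(t)+F_cw_c(t);\qquad z_d(k)=C_dx(t_k)+F_dw_d(k),\ k\ge1;\qquad x(0)=x(0^+)=x_0\in\mathbb{R}^n.$$ Assume that there exist a vector $\lambda\in\mathbb{R}^n_{>0}$ and a scalar $\gamma>0$ such that the conditions $$A\lambda+E_c\mathbf 1<0,\qquad C_c\lambda+F_c\mathbf 1-\gamma\mathbf 1<0,\qquad (J-I)\lambda+E_d\mathbf 1<0,\qquad C_d\lambda+F_d\mathbf 1-\gamma\mathbf 1<0$$ hold. Then the system is uniformly exponentially stable under arbitrary dwell-time and the hybrid $L_\infty\times\ell_\infty$-gain of the transfer $(w_c,w_d)\mapsto(z_c,z_d)$ is at most $\gamma$.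
   Context: Inequalities are componentwise; $\mathbf 1$ is the all-ones vector; $f(t^+)=\lim_{s\downarrow t}f(s)$; solutions are left-continuous. Positive system: $A$ is Metzler (nonnegative off-diagonal entries) and $E_c,C_c,F_c,J,E_d,C_d,F_d$ are nonnegative. Arbitrary dwell-time: all impulse sequences with $t_0=0$, $t_{k+1}-t_k\in(0,\infty)$ and $t_k\to\infty$ are considered. Uniform exponential stability: there exist $M>0$, $\rho\in(0,1)$, $\alpha>0$ such that, for $w_c,w_d\equiv0$, $\|x(t)\|\le M\rho^{\kappa(t,t_0)}e^{-\alpha(t-t_0)}\|x_0\|$ for all $t\ge t_0$ and all these sequences, where $\kappa(t,s)$ is the number of jumps between $s$ and $t$. The hybrid $L_\infty\times\ell_\infty$-gain is the supremum of $\max\{\|z_c\|_{L_\infty},\|z_d\|_{\ell_\infty}\}$ over inputs with $\max\{\|w_c\|_{L_\infty},\|w_d\|_{\ell_\infty}\}=1$, $x_0=0$, and over all these sequences (vector $\infty$-norm pointwise). *)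

theory Defs
  imports "HOL-Analysis.Analysis" "HOL-Probability.Essential_Supremum"
begin

text \<open>
  The matrices of an impulsive system are passed in the order
  \<open>A Ec J Ed Cc Fc Cd Fd\<close> (flow, jump, continuous output, discrete output). On vectors and
  matrices \<open>\<le>\<close> is the componentwise order and \<open>1 :: real ^ 'n\<close> is the all-ones vector. The
  library's \<open><\<close> on vectors is not the componentwise strict order, so strict vector
  inequalities are written out by components; likewise the identity matrix is \<open>mat 1\<close>.
\<close>

definition metzler :: "real ^ 'n ^ 'n \<Rightarrow> bool" where
  "metzler A \<longleftrightarrow> (\<forall>i j. i \<noteq> j \<longrightarrow> 0 \<le> A $ i $ j)"

definition positive_system ::
  "real ^ 'n ^ 'n \<Rightarrow> real ^ 'p ^ 'n \<Rightarrow> real ^ 'n ^ 'n \<Rightarrow> real ^ 'q ^ 'n \<Rightarrow>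
   real ^ 'n ^ 'r \<Rightarrow> real ^ 'p ^ 'r \<Rightarrow> real ^ 'n ^ 's \<Rightarrow> real ^ 'q ^ 's \<Rightarrow> bool" where
  "positive_system A Ec J Ed Cc Fc Cd Fd \<longleftrightarrow>
     metzler A \<and> 0 \<le> Ec \<and> 0 \<le> J \<and> 0 \<le> Ed \<and> 0 \<le> Cc \<and> 0 \<le> Fc \<and> 0 \<le> Cd \<and> 0 \<le> Fd"

definition impulse_sequence :: "(nat \<Rightarrow> real) \<Rightarrow> bool" where
  "impulse_sequence \<tau> \<longleftrightarrow>
     \<tau> 0 = 0 \<and> (\<forall>k. \<tau> k < \<tau> (Suc k)) \<and> filterlim \<tau> at_top sequentially"

text \<open>
  Since \<open>wc\<close> is merely measurable, the differential equation on \<open>(\<tau> k, \<tau> (k+1)]\<close> is understood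
  in the sense of Caratheodory, that is, as an integral equation (Lebesgue integral; it includes
  left-continuity at \<open>\<tau> (k+1)\<close>). The right limit at \<open>\<tau> 0 = 0\<close> is the initial value; a jump takes
  place only at \<open>\<tau> k\<close> with \<open>k \<ge> 1\<close>. Values at negative times and the value \<open>wd 0\<close> play no role.
\<close>

definition is_solution ::
  "real ^ 'n ^ 'n \<Rightarrow> real ^ 'p ^ 'n \<Rightarrow> real ^ 'n ^ 'n \<Rightarrow> real ^ 'q ^ 'n \<Rightarrow> (nat \<Rightarrow> real) \<Rightarrow>
   (real \<Rightarrow> real ^ 'p) \<Rightarrow> (nat \<Rightarrow> real ^ 'q) \<Rightarrow> real ^ 'n \<Rightarrow> (real \<Rightarrow> real ^ 'n) \<Rightarrow> bool" where
  "is_solution A Ec J Ed \<tau> wc wd x0 x \<longleftrightarrow>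
     x 0 = x0 \<and> (x \<longlongrightarrow> x0) (at_right 0) \<and>
     (\<forall>k\<ge>1. (x \<longlongrightarrow> J *v x (\<tau> k) + Ed *v wd k) (at_right (\<tau> k))) \<and>
     (\<forall>k s t. \<tau> k < s \<and> s \<le> t \<and> t \<le> \<tau> (Suc k) \<longrightarrow>
        (\<lambda>u. A *v x u + Ec *v wc u) absolutely_integrable_on {s..t} \<and>
        x t - x s = integral {s..t} (\<lambda>u. A *v x u + Ec *v wc u))"

definition num_jumps :: "(nat \<Rightarrow> real) \<Rightarrow> real \<Rightarrow> real \<Rightarrow> nat" where
  "num_jumps \<tau> t s = card {k. 1 \<le> k \<and> s \<le> \<tau> k \<and> \<tau> k \<le> t}"

definition uniformly_exp_stable ::
  "real ^ 'n ^ 'n \<Rightarrow> real ^ 'p ^ 'n \<Rightarrow> real ^ 'n ^ 'n \<Rightarrow> real ^ 'q ^ 'n \<Rightarrow> bool" where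
  "uniformly_exp_stable A Ec J Ed \<longleftrightarrow>
     (\<exists>M \<rho> \<alpha>. 0 < M \<and> 0 < \<rho> \<and> \<rho> < 1 \<and> 0 < \<alpha> \<and>
        (\<forall>\<tau> x0 x. impulse_sequence \<tau> \<and> is_solution A Ec J Ed \<tau> (\<lambda>_. 0) (\<lambda>_. 0) x0 x \<longrightarrow>
           (\<forall>t\<ge>\<tau> 0. norm (x t) \<le>
              M * \<rho> ^ num_jumps \<tau> t (\<tau> 0) * exp (- \<alpha> * (t - \<tau> 0)) * norm x0)))"

definition Linf_norm :: "(real \<Rightarrow> real ^ 'm) \<Rightarrow> ennreal" where
  "Linf_norm f = esssup (lebesgue_on {0..}) (\<lambda>t. ennreal (infnorm (f t)))"

definition linf_norm :: "(nat \<Rightarrow> real ^ 'm) \<Rightarrow> ennreal" where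
  "linf_norm f = (SUP k\<in>{1..}. ennreal (infnorm (f k)))"

definition hybrid_gain ::
  "real ^ 'n ^ 'n \<Rightarrow> real ^ 'p ^ 'n \<Rightarrow> real ^ 'n ^ 'n \<Rightarrow> real ^ 'q ^ 'n \<Rightarrow>
   real ^ 'n ^ 'r \<Rightarrow> real ^ 'p ^ 'r \<Rightarrow> real ^ 'n ^ 's \<Rightarrow> real ^ 'q ^ 's \<Rightarrow> ennreal" where
  "hybrid_gain A Ec J Ed Cc Fc Cd Fd =
     Sup {max (Linf_norm (\<lambda>t. Cc *v x t + Fc *v wc t))
              (linf_norm (\<lambda>k. Cd *v x (\<tau> k) + Fd *v wd k)) | \<tau> wc wd x.
            impulse_sequence \<tau> \<and>
            wc \<in> borel_measurable (lebesgue_on {0..}) \<and>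
            max (Linf_norm wc) (linf_norm wd) = 1 \<and>
            is_solution A Ec J Ed \<tau> wc wd 0 x}"

end

theory Submission
  imports Defs
begin

text \<open>
  The vector \<open>l\<close> describes a box \<open>{x. \<bar>x\<bar> \<le> l}\<close> that the system cannot leave when it is started
  in it and driven by inputs bounded by \<open>1\<close>. At a jump this holds because nonnegative matrices
  respect componentwise bounds: \<open>\<bar>J x + Ed w\<bar> \<le> J l + Ed 1 < l\<close>. Along the flow it is a
  comparison principle: the gap \<open>d = l - x\<close> satisfies \<open>d' \<ge> A d + \<epsilon>\<close> for some \<open>\<epsilon> > 0\<close>, because
  \<open>A l + Ec 1 < 0\<close>, and as \<open>A\<close> is Metzler, a component of \<open>d\<close> that vanishes while the others are
  nonnegative is pushed upwards. The same holds for \<open>- x\<close>, as the inputs may have either sign.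
  From \<open>\<bar>x\<bar> \<le> l\<close> the outputs are bounded by \<open>Cc l + Fc 1\<close> and \<open>Cd l + Fd 1\<close>, hence by \<open>\<gamma>\<close>.

  Without inputs there is room to let the box shrink. Strictness gives \<open>\<alpha> > 0\<close> with
  \<open>A l < - \<alpha> l\<close> and \<open>\<rho> < 1\<close> with \<open>J l \<le> \<rho> l\<close>, so the box \<open>c \<rho>\<^sup>k exp (- \<alpha> t) l\<close>, where \<open>k\<close> counts
  the past jumps, still contains the solution; neither constant depends on the impulse times.

  Both statements therefore follow from one comparison theorem for the hybrid system,
  \<open>hybrid_abs_le_strict_supersolution\<close>. The inputs are only measurable, so \<open>x\<close> need not be
  differentiable everywhere. The comparison is therefore carried out on increments over
  intervals, that is, on the integral equation, and never on derivatives of \<open>x\<close>.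
\<close>

section \<open>Comparison for flows with a Metzler matrix\<close>

text \<open>
  The integral form of: \<open>d' \<ge> A d + \<epsilon>\<close> keeps \<open>d\<close> nonnegative. Let \<open>T\<close> be the infimum of the times
  at which \<open>d\<close> is outside the nonnegative orthant. A component that is positive at \<open>T\<close> stays so for
  a while. For one that vanishes at \<open>T\<close> the diagonal entry of \<open>A\<close> does not contribute, so its
  growth rate at \<open>T\<close> is at least \<open>\<epsilon>\<close>; by continuity the rate is positive shortly after \<open>T\<close>, and the
  component increases. So \<open>d\<close> remains in the orthant beyond \<open>T\<close>. The growth
  condition refers to \<open>{a<..b}\<close>, since the integral equation of the system starts after a jump.
\<close>

lemma metzler_flow_nonneg:
  fixes A :: "real ^ 'n ^ 'n" and d :: "real \<Rightarrow> real ^ 'n"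
  assumes metzler: "metzler A" and "0 < \<epsilon>"
    and cont: "continuous_on {a..b} d" and init: "0 \<le> d a"
    and growth: "\<And>i s t. a < s \<Longrightarrow> s \<le> t \<Longrightarrow> t \<le> b \<Longrightarrow>
      integral {s..t} (\<lambda>u. (A *v d u) $ i + \<epsilon>) \<le> d t $ i - d s $ i"
    and t: "t \<in> {a..b}"
  shows "0 \<le> d t"
proof (rule ccontr)
  define B where "B = {t \<in> {a..b}. \<not> 0 \<le> d t}"
  define T where "T = Inf B"
  assume "\<not> 0 \<le> d t"
  then have B: "B \<noteq> {}" "bdd_below B"
    using t by (auto simp: B_def intro!: bdd_belowI[of _ a])
  have T: "a \<le> T" "T \<le> b"
  proof -
    show "a \<le> T"
      unfolding T_def by (rule cInf_greatest[OF B(1)]) (auto simp: B_def)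
    obtain s where "s \<in> B" using B(1) by blast
    then show "T \<le> b"
      using cInf_lower[OF _ B(2), of s] by (auto simp: T_def B_def)
  qed
  have before: "0 \<le> d s" if "a \<le> s" "s < T" for s
    using that T cInf_lower[OF _ B(2), of s] by (force simp: B_def T_def)
  have dcont: "continuous (at T within {a..b}) d"
    using cont T by (auto simp: continuous_on_eq_continuous_within)
  have atT: "0 \<le> d T"
  proof (cases "T = a")
    case False
    then have "a < T" using T by simp
    have left: "(d \<longlongrightarrow> d T) (at_left T)"
      using continuous_on_subset[OF cont, of "{a..T}"] \<open>a < T\<close> T
      by (auto simp: continuous_on_eq_continuous_within continuous_within
            simp flip: at_within_Icc_at_left)
    have "eventually (\<lambda>s. 0 \<le> d s) (at_left T)"
      using eventually_at_left_real[OF \<open>a < T\<close>] by eventually_elim (auto intro: before)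
    then have "eventually (\<lambda>s. 0 \<le> d s $ i) (at_left T)" for i
      by eventually_elim (simp add: less_eq_vec_def)
    then have "0 \<le> d T $ i" for i
      by (intro tendsto_lowerbound[OF tendsto_vec_nth[OF left]]) auto
    then show ?thesis by (simp add: less_eq_vec_def)
  qed (use init in simp)
  have notB: "s \<notin> B" if "s \<le> T" for s
    using that before[of s] atT by (cases "s = T") (auto simp: B_def)
  have "T < b"
  proof (rule ccontr)
    assume "\<not> T < b"
    then have "B = {}"
      using notB by (force simp: B_def)
    with B(1) show False by simp
  qed
  have right: "(d \<longlongrightarrow> d T) (at_right T)"
    using continuous_on_subset[OF cont, of "{T..b}"] \<open>T < b\<close> T
    by (auto simp: continuous_on_eq_continuous_within continuous_within
          simp flip: at_within_Icc_at_right)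
  have "eventually (\<lambda>t. 0 \<le> d t $ i) (at_right T)" for i
  proof (cases "d T $ i = 0")
    case False
    then have "0 < d T $ i"
      using atT by (auto simp: less_eq_vec_def order.order_iff_strict)
    from order_tendstoD(1)[OF tendsto_vec_nth[OF right] this]
    show ?thesis by eventually_elim simp
  next
    case True
    have "0 \<le> (A *v d T) $ i"
      unfolding matrix_vector_mult_def
    proof (simp, intro sum_nonneg)
      fix j show "0 \<le> A $ i $ j * d T $ j"
        using metzler atT True by (cases "j = i") (auto simp: metzler_def less_eq_vec_def)
    qed
    then have "0 < (A *v d T) $ i + \<epsilon>" using \<open>0 < \<epsilon>\<close> by simp
    moreover have "((\<lambda>u. (A *v d u) $ i + \<epsilon>) \<longlongrightarrow> (A *v d T) $ i + \<epsilon>) (at_right T)"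
      by (intro tendsto_intros
          bounded_linear.tendsto[OF matrix_vector_mul_bounded_linear right])
    ultimately have "eventually (\<lambda>u. 0 < (A *v d u) $ i + \<epsilon>) (at_right T)"
      by (rule order_tendstoD(1)[rotated])
    then obtain T' where T': "T < T'"
      and pos: "\<And>u. T < u \<Longrightarrow> u < T' \<Longrightarrow> 0 < (A *v d u) $ i + \<epsilon>"
      by (auto simp: eventually_at_right_field)
    have "0 \<le> d t $ i" if t: "T < t" "t < min T' b" for t
    proof -
      \<comment> \<open>The increment is available from \<open>s > T\<close> only, as possibly \<open>T = a\<close>; then let \<open>s\<close> tend to \<open>T\<close>.\<close>
      have "d s $ i \<le> d t $ i" if "T < s" "s < t" for s
      proof -
        have "continuous_on {s..t} (\<lambda>u. (A *v d u) $ i + \<epsilon>)"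
          by (intro continuous_intros
              bounded_linear.continuous_on[OF matrix_vector_mul_bounded_linear]
              continuous_on_subset[OF cont]) (use that t T in auto)
        then have "0 \<le> integral {s..t} (\<lambda>u. (A *v d u) $ i + \<epsilon>)"
          by (intro integral_nonneg integrable_continuous_real)
            (use pos that t in \<open>auto intro!: less_imp_le\<close>)
        also have "\<dots> \<le> d t $ i - d s $ i"
          by (rule growth) (use that t T in auto)
        finally show ?thesis by simp
      qed
      then have "eventually (\<lambda>s. d s $ i \<le> d t $ i) (at_right T)"
        using t by (auto simp: eventually_at_right_field)
      then have "d T $ i \<le> d t $ i"
        by (intro tendsto_upperbound[OF tendsto_vec_nth[OF right]]) auto
      then show ?thesis using True by simp
    qed
    then show ?thesis
      using T' \<open>T < b\<close> by (auto simp: eventually_at_right_field intro!: exI[of _ "min T' b"])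
  qed
  then have "eventually (\<lambda>t. 0 \<le> d t) (at_right T)"
    by (simp add: less_eq_vec_def eventually_all_finite)
  then obtain T' where T': "T < T'" "\<And>t. T < t \<Longrightarrow> t < T' \<Longrightarrow> 0 \<le> d t"
    by (auto simp: eventually_at_right_field)
  have "T' \<le> s" if "s \<in> B" for s
    using notB[of s] T'(2)[of s] that by (force simp: B_def)
  then have "T' \<le> T"
    using cInf_greatest[OF B(1)] by (simp add: T_def)
  with T'(1) show False by simp
qed

text \<open>
  No integrability up to \<open>a\<close> is assumed, so continuity at a point \<open>u\<close> is read off the integral
  equation on \<open>{s..b}\<close> with \<open>s\<close> between \<open>a\<close> and \<open>u\<close>.
\<close>

lemma continuous_on_half_open_flow:
  fixes x :: "real \<Rightarrow> real ^ 'n"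
  assumes flow: "\<And>s t. a < s \<Longrightarrow> s \<le> t \<Longrightarrow> t \<le> b \<Longrightarrow>
      f integrable_on {s..t} \<and> x t - x s = integral {s..t} f"
  shows "continuous_on {a<..b} x"
proof (unfold continuous_on_eq_continuous_within, rule ballI)
  fix u assume u: "u \<in> {a<..b}"
  define s where "s = (a + u) / 2"
  have s: "a < s" "s < u" "s \<le> b" using u by (auto simp: s_def field_simps)
  have "continuous_on {s..b} (\<lambda>t. x s + integral {s..t} f)"
    using flow[of s b] s u by (intro continuous_intros indefinite_integral_continuous_1) auto
  then have "continuous_on {s..b} x"
  proof (rule continuous_on_eq)
    fix t assume "t \<in> {s..b}"
    then show "x s + integral {s..t} f = x t"
      using flow[of s t] s by (simp add: algebra_simps)
  qed
  then have "continuous (at u within {s..b}) x"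
    using s u by (auto simp: continuous_on_eq_continuous_within)
  also have "at u within {s..b} = at u within {a<..b}"
    by (rule at_within_nhd[of u "{s<..}"]) (use s u in auto)
  finally show "continuous (at u within {a<..b}) x" .
qed

text \<open>
  At a jump time the left-continuous solution carries the value before the jump. Replacing it by
  the right limit makes one flow phase continuous on a compact interval.
\<close>

lemma continuous_on_extend_right_limit:
  fixes x :: "real \<Rightarrow> real ^ 'n"
  assumes cont: "continuous_on {a<..b} x" and lim: "(x \<longlongrightarrow> y) (at_right a)" and "a < b"
  shows "continuous_on {a..b} (\<lambda>t. if t \<le> a then y else x t)" (is "continuous_on _ ?X")
proof (unfold continuous_on_eq_continuous_within, rule ballI)
  fix u assume u: "u \<in> {a..b}"
  show "continuous (at u within {a..b}) ?X"
  proof (cases "u = a")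
    case True
    have "(?X \<longlongrightarrow> y) (at_right a)"
      by (rule Lim_transform_eventually[OF lim])
        (auto simp: eventually_at_right_field intro: exI[of _ "a + 1"])
    then show ?thesis
      using True \<open>a < b\<close> by (simp add: continuous_within at_within_Icc_at_right)
  next
    case False
    have "continuous_on {a<..b} ?X"
      by (rule continuous_on_eq[OF cont]) auto
    then have "continuous (at u within {a<..b}) ?X"
      using u False by (auto simp: continuous_on_eq_continuous_within)
    also have "at u within {a<..b} = at u within {a..b}"
      by (rule at_within_nhd[of u "{a<..}"]) (use u False in auto)
    finally show ?thesis .
  qed
qed

text \<open>
  If \<open>x' = A x + g\<close> with \<open>g \<le> h\<close> almost everywhere, and \<open>v' \<ge> A v + h + \<epsilon>\<close>, then \<open>d = v - x\<close> satisfies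
  \<open>d' \<ge> A d + \<epsilon>\<close>, so that \<open>metzler_flow_nonneg\<close> applies. The slack \<open>\<epsilon> > 0\<close> will come from the
  strictness of the flow condition on \<open>l\<close>.
\<close>

lemma flow_le_strict_supersolution:
  fixes A :: "real ^ 'n ^ 'n" and x g v v' :: "real \<Rightarrow> real ^ 'n"
  assumes metzler: "metzler A" and "a < b" and lim: "(x \<longlongrightarrow> y) (at_right a)"
    and flow: "\<And>s t. a < s \<Longrightarrow> s \<le> t \<Longrightarrow> t \<le> b \<Longrightarrow>
      (\<lambda>u. A *v x u + g u) integrable_on {s..t} \<and>
      x t - x s = integral {s..t} (\<lambda>u. A *v x u + g u)"
    and N: "negligible N" and input: "\<And>u. u \<in> {a<..b} - N \<Longrightarrow> g u \<le> h"
    and deriv: "\<And>t. t \<in> {a..b} \<Longrightarrow> (v has_vector_derivative v' t) (at t within {a..b})"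
    and "0 < \<epsilon>" and super: "\<And>t i. t \<in> {a..b} \<Longrightarrow> (A *v v t + h) $ i + \<epsilon> \<le> v' t $ i"
    and init: "y \<le> v a" and t: "t \<in> {a<..b}"
  shows "x t \<le> v t"
proof -
  define d where "d = (\<lambda>t. v t - (if t \<le> a then y else x t))"
  have xcont: "continuous_on {a<..b} x"
    using flow by (rule continuous_on_half_open_flow)
  have vcont: "continuous_on {a..b} v"
    by (auto simp: continuous_on_eq_continuous_within
        intro: has_vector_derivative_continuous deriv)
  have dcont: "continuous_on {a..b} d"
    unfolding d_def
    by (intro continuous_on_diff vcont continuous_on_extend_right_limit[OF xcont lim \<open>a < b\<close>])
  have "0 \<le> d t"
  proof (rule metzler_flow_nonneg[OF metzler \<open>0 < \<epsilon>\<close> dcont])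
    show "0 \<le> d a" using init by (simp add: d_def less_eq_vec_def)
    show "t \<in> {a..b}" using t by simp
    fix i s t assume st: "a < s" "s \<le> t" "t \<le> b"
    let ?f = "\<lambda>u. v' u $ i - (A *v x u + g u) $ i"
    let ?r = "\<lambda>u. (A *v d u) $ i + \<epsilon>"
    have "(v' has_integral (v t - v s)) {s..t}"
      using st by (intro fundamental_theorem_of_calculus)
        (auto intro: has_vector_derivative_within_subset[OF deriv])
    moreover have "((\<lambda>u. A *v x u + g u) has_integral (x t - x s)) {s..t}"
      using flow[OF st] by (auto intro: integrable_integral)
    ultimately have "((\<lambda>u. (v' u - (A *v x u + g u)) $ i) has_integral
        ((v t - v s) - (x t - x s)) $ i) {s..t}"
      by (intro has_integral_linear[OF _ bounded_linear_vec_nth, unfolded o_def]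
          has_integral_diff)
    then have f: "(?f has_integral (d t $ i - d s $ i)) {s..t}"
      using st by (simp add: d_def algebra_simps)
    have le: "?r u \<le> ?f u" if "u \<in> {s..t} - N" for u
    proof -
      have "g u $ i \<le> h $ i"
        using input[of u] that st by (auto simp: less_eq_vec_def)
      moreover have "(A *v v u + h) $ i + \<epsilon> \<le> v' u $ i"
        by (rule super) (use that st in auto)
      moreover have "d u = v u - x u" using that st by (simp add: d_def)
      ultimately show ?thesis by (simp add: matrix_vector_mult_diff_distrib)
    qed
    have "continuous_on {s..t} ?r"
      by (intro continuous_intros
          bounded_linear.continuous_on[OF matrix_vector_mul_bounded_linear]
          continuous_on_subset[OF dcont]) (use st in auto)
    then have r: "(?r has_integral integral {s..t} ?r) {s..t}"
      by (intro integrable_integral integrable_continuous_real)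
    \<comment> \<open>Changing the integrand on the null set \<open>N\<close> turns the a.e. bound into a pointwise one.\<close>
    have f': "((\<lambda>u. if u \<in> N then ?r u else ?f u) has_integral (d t $ i - d s $ i)) {s..t}"
      by (rule has_integral_spike[OF N _ f]) auto
    show "integral {s..t} ?r \<le> d t $ i - d s $ i"
      by (rule has_integral_le[OF r f']) (use le in auto)
  qed
  then show ?thesis using t by (simp add: d_def less_eq_vec_def)
qed


section \<open>Componentwise bounds\<close>

lemma abs_vec_le_iff: "\<bar>u :: real ^ 'n\<bar> \<le> b \<longleftrightarrow> (\<forall>i. \<bar>u $ i\<bar> \<le> b $ i)"
  by (simp add: less_eq_vec_def abs_vec_def)

lemma abs_vec_le_iff_two_sided: "\<bar>u :: real ^ 'n\<bar> \<le> b \<longleftrightarrow> u \<le> b \<and> - u \<le> b"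
  unfolding abs_vec_le_iff by (auto simp: less_eq_vec_def abs_le_iff)

lemma infnorm_le_iff: "infnorm (u :: real ^ 'n) \<le> c \<longleftrightarrow> \<bar>u\<bar> \<le> c *\<^sub>R 1"
proof -
  have "{\<bar>u $ i\<bar> |i. i \<in> UNIV} = range (\<lambda>i. \<bar>u $ i\<bar>)" by auto
  then show ?thesis
    by (simp add: infnorm_cart abs_vec_le_iff cSup_le_iff)
qed

lemma nonneg_matrix_abs_le:
  fixes P :: "real ^ 'm ^ 'n"
  assumes "0 \<le> P" "\<bar>w\<bar> \<le> b"
  shows "\<bar>P *v w\<bar> \<le> P *v b"
  unfolding abs_vec_le_iff
proof
  fix i
  have w: "\<bar>w $ j\<bar> \<le> b $ j" for j
    using assms(2) by (simp add: abs_vec_le_iff)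
  have "\<bar>(P *v w) $ i\<bar> \<le> (\<Sum>j\<in>UNIV. \<bar>P $ i $ j * w $ j\<bar>)"
    by (simp add: matrix_vector_mult_def)
  also have "\<dots> \<le> (\<Sum>j\<in>UNIV. P $ i $ j * b $ j)"
    using assms(1) by (intro sum_mono)
      (auto simp: abs_mult less_eq_vec_def intro!: mult_left_mono w)
  finally show "\<bar>(P *v w) $ i\<bar> \<le> (P *v b) $ i"
    by (simp add: matrix_vector_mult_def)
qed

lemma nonneg_matrix_abs_add_le:
  fixes P :: "real ^ 'm ^ 'n" and Q :: "real ^ 'k ^ 'n"
  assumes "0 \<le> P" "\<bar>u\<bar> \<le> a" "0 \<le> Q" "\<bar>w\<bar> \<le> b"
  shows "\<bar>P *v u + Q *v w\<bar> \<le> P *v a + Q *v b"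
  using nonneg_matrix_abs_le[OF assms(1,2)] nonneg_matrix_abs_le[OF assms(3,4)]
  by (auto simp: abs_vec_le_iff intro: order_trans[OF abs_triangle_ineq] add_mono)

text \<open>
  Finitely many strict inequalities have a common slack. With different weights \<open>w\<close> this yields
  the decay rate, the contraction factor and the slack \<open>\<epsilon>\<close> that the comparison principle needs.
\<close>

lemma uniform_gap:
  fixes f g w :: "'n :: finite \<Rightarrow> real"
  assumes "\<And>i. f i < g i"
  obtains m where "0 < m" "m < 1" "\<And>i. f i + m * w i \<le> g i"
proof -
  have "eventually (\<lambda>m. f i + m * w i \<le> g i) (at_right 0)" for i
  proof -
    have "((\<lambda>m. f i + m * w i) \<longlongrightarrow> f i + 0 * w i) (at_right 0)"
      by (intro tendsto_intros)
    then have "eventually (\<lambda>m. f i + m * w i < g i) (at_right 0)"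
      using assms[of i] by (intro order_tendstoD(2)) simp_all
    then show ?thesis by eventually_elim simp
  qed
  then have "eventually (\<lambda>m. \<forall>i. f i + m * w i \<le> g i) (at_right 0)"
    by (simp add: eventually_all_finite)
  then have "eventually (\<lambda>m. (\<forall>i. f i + m * w i \<le> g i) \<and> m \<in> {0<..<1}) (at_right 0)"
    by (intro eventually_conj eventually_at_right_real) auto
  then show ?thesis
    using that by (auto dest!: eventually_happens)
qed

section \<open>Impulse times and solutions\<close>

lemma impulse_sequence_strict_mono: "impulse_sequence \<tau> \<Longrightarrow> strict_mono \<tau>"
  by (simp add: impulse_sequence_def strict_mono_Suc_iff)

lemma impulse_time_nonneg: "impulse_sequence \<tau> \<Longrightarrow> 0 \<le> \<tau> k"
  using strict_mono_less_eq[OF impulse_sequence_strict_mono, of \<tau> 0 k]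
  by (simp add: impulse_sequence_def)

lemma impulse_interval:
  assumes "impulse_sequence \<tau>" "0 < t"
  obtains k where "t \<in> {\<tau> k<..\<tau> (Suc k)}"
proof -
  have "eventually (\<lambda>k. t \<le> \<tau> k) sequentially"
    using assms(1) by (auto simp: impulse_sequence_def filterlim_at_top)
  then have ex: "\<exists>k. t \<le> \<tau> k" by (auto dest: eventually_happens)
  define n where "n = (LEAST k. t \<le> \<tau> k)"
  have n: "t \<le> \<tau> n" unfolding n_def by (rule LeastI_ex[OF ex])
  then have "n \<noteq> 0" using assms by (auto simp: impulse_sequence_def intro!: gr0I)
  then obtain k where k: "n = Suc k" by (cases n) auto
  then have "\<tau> k < t" using not_less_Least[of k "\<lambda>k. t \<le> \<tau> k"] by (simp add: n_def)
  then show ?thesis using that[of k] n k by simp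
qed

text \<open>
  At \<open>t = \<tau> (Suc k)\<close> the jump at \<open>t\<close> itself is counted although the left-continuous solution has
  performed only \<open>k\<close> jumps; the stability constant absorbs this extra factor.
\<close>

lemma num_jumps_le:
  assumes "impulse_sequence \<tau>" "t \<le> \<tau> (Suc k)"
  shows "num_jumps \<tau> t s \<le> Suc k"
proof -
  have "{j. 1 \<le> j \<and> s \<le> \<tau> j \<and> \<tau> j \<le> t} \<subseteq> {1..Suc k}"
    using assms(2) strict_mono_less_eq[OF impulse_sequence_strict_mono[OF assms(1)]]
    by (auto dest: order_trans)
  then have "num_jumps \<tau> t s \<le> card {1..Suc k}"
    unfolding num_jumps_def by (intro card_mono) auto
  then show ?thesis by simp
qed

lemma is_solution_flow:
  assumes "is_solution A Ec J Ed \<tau> wc wd x0 x"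
    and "\<tau> k < s" "s \<le> t" "t \<le> \<tau> (Suc k)"
  shows "(\<lambda>u. A *v x u + Ec *v wc u) integrable_on {s..t} \<and>
    x t - x s = integral {s..t} (\<lambda>u. A *v x u + Ec *v wc u)"
proof -
  have "(\<lambda>u. A *v x u + Ec *v wc u) absolutely_integrable_on {s..t}"
      "x t - x s = integral {s..t} (\<lambda>u. A *v x u + Ec *v wc u)"
    using assms unfolding is_solution_def by blast+
  then show ?thesis by (simp add: set_lebesgue_integral_eq_integral(1))
qed

lemma is_solution_continuous_on:
  assumes "is_solution A Ec J Ed \<tau> wc wd x0 x"
  shows "continuous_on {\<tau> k<..\<tau> (Suc k)} x"
  using is_solution_flow[OF assms] by (rule continuous_on_half_open_flow)

text \<open>
  The essential supremum of a function that is not measurable is infinite, so a bound on the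
  norm of the output requires measurability. It holds since the solution is continuous on each of
  the countably many flow phases.
\<close>

lemma is_solution_measurable:
  assumes \<tau>: "impulse_sequence \<tau>" and x: "is_solution A Ec J Ed \<tau> wc wd x0 x"
  shows "x \<in> borel_measurable (lebesgue_on {0..})"
proof (rule measurable_piecewise_restrict[where C = "insert {0} (range (\<lambda>k. {\<tau> k<..\<tau> (Suc k)}))"])
  show "countable (insert {0} (range (\<lambda>k. {\<tau> k<..\<tau> (Suc k)})))" by simp
  show "space (lebesgue_on {0..}) \<subseteq> \<Union> (insert {0} (range (\<lambda>k. {\<tau> k<..\<tau> (Suc k)})))"
  proof
    fix t :: real assume "t \<in> space (lebesgue_on {0..})"
    then have "t = 0 \<or> 0 < t" by auto
    then show "t \<in> \<Union> (insert {0} (range (\<lambda>k. {\<tau> k<..\<tau> (Suc k)})))"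
    proof
      assume "0 < t"
      then obtain k where "t \<in> {\<tau> k<..\<tau> (Suc k)}" by (rule impulse_interval[OF \<tau>])
      then show ?thesis by blast
    qed simp
  qed
  fix \<Omega> assume \<Omega>: "\<Omega> \<in> insert {0} (range (\<lambda>k. {\<tau> k<..\<tau> (Suc k)}))"
  have sub: "\<Omega> \<subseteq> {0..}"
  proof (cases "\<Omega> = {0}")
    case False
    then obtain k where "\<Omega> = {\<tau> k<..\<tau> (Suc k)}" using \<Omega> by blast
    then show ?thesis using impulse_time_nonneg[OF \<tau>, of k] by auto
  qed simp
  have sets: "\<Omega> \<in> sets lebesgue" using \<Omega> by auto
  from sub sets show "\<Omega> \<inter> space (lebesgue_on {0..}) \<in> sets (lebesgue_on {0..})"
    by (auto simp: sets_restrict_space)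
  have "continuous_on \<Omega> x"
    using \<Omega> is_solution_continuous_on[OF x] by auto
  then have "x \<in> borel_measurable (lebesgue_on \<Omega>)"
    using sets by (rule continuous_imp_measurable_on_sets_lebesgue)
  moreover have "restrict_space (lebesgue_on {0..}) \<Omega> = lebesgue_on \<Omega>"
    using sub by (simp add: restrict_restrict_space sets Int_absorb1)
  ultimately show "x \<in> borel_measurable (restrict_space (lebesgue_on {0..}) \<Omega>)"
    by simp
qed

section \<open>Comparison for the hybrid system\<close>

text \<open>
  Induction over the flow phases, with a separate bound \<open>v k\<close> on each phase. The invariant
  concerns the value \<open>y k\<close> right after the \<open>k\<close>-th jump: \<open>\<bar>y k\<bar> \<le> v k (\<tau> k)\<close> propagates along the phase by
  \<open>flow_le_strict_supersolution\<close> applied to \<open>x\<close> and to \<open>- x\<close>, and across the next jump by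
  nonnegativity of \<open>J\<close> and \<open>Ed\<close>.
\<close>

lemma hybrid_abs_le_strict_supersolution:
  fixes A J :: "real ^ 'n ^ 'n" and v v' :: "nat \<Rightarrow> real \<Rightarrow> real ^ 'n"
  assumes metzler: "metzler A" and nonneg: "0 \<le> Ec" "0 \<le> J" "0 \<le> Ed"
    and \<tau>: "impulse_sequence \<tau>" and x: "is_solution A Ec J Ed \<tau> wc wd x0 x"
    and N: "negligible N" and wc: "\<And>u. 0 < u \<Longrightarrow> u \<notin> N \<Longrightarrow> \<bar>wc u\<bar> \<le> bc"
    and wd: "\<And>k. 1 \<le> k \<Longrightarrow> \<bar>wd k\<bar> \<le> bd"
    and init: "\<bar>x0\<bar> \<le> v 0 0"
    and deriv: "\<And>k t. (v k has_vector_derivative v' k t) (at t)"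
    and super: "\<And>k. \<exists>\<epsilon>>0. \<forall>t\<in>{\<tau> k..\<tau> (Suc k)}. \<forall>i.
      (A *v v k t + Ec *v bc) $ i + \<epsilon> \<le> v' k t $ i"
    and jump: "\<And>k. J *v v k (\<tau> (Suc k)) + Ed *v bd \<le> v (Suc k) (\<tau> (Suc k))"
    and t: "t \<in> {\<tau> k<..\<tau> (Suc k)}"
  shows "\<bar>x t\<bar> \<le> v k t"
proof -
  define y where "y k = (if k = 0 then x0 else J *v x (\<tau> k) + Ed *v wd k)" for k
  have lim: "(x \<longlongrightarrow> y k) (at_right (\<tau> k))" for k
    using \<tau> x by (cases "k = 0") (auto simp: y_def is_solution_def impulse_sequence_def)
  have less: "\<tau> k < \<tau> (Suc k)" for k
    using \<tau> by (simp add: impulse_sequence_def)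
  have flow_bound: "\<bar>x t\<bar> \<le> v k t" if yk: "\<bar>y k\<bar> \<le> v k (\<tau> k)" and t: "t \<in> {\<tau> k<..\<tau> (Suc k)}" for k t
  proof -
    obtain \<epsilon> where "0 < \<epsilon>" and
      \<epsilon>: "\<And>t i. t \<in> {\<tau> k..\<tau> (Suc k)} \<Longrightarrow> (A *v v k t + Ec *v bc) $ i + \<epsilon> \<le> v' k t $ i"
      using super[of k] by blast
    have input: "\<bar>Ec *v wc u\<bar> \<le> Ec *v bc" if "u \<in> {\<tau> k<..\<tau> (Suc k)} - N" for u
      using that impulse_time_nonneg[OF \<tau>, of k] by (intro nonneg_matrix_abs_le nonneg wc) auto
    have "x t \<le> v k t"
      by (rule flow_le_strict_supersolution[OF metzler less lim _ N _ _ \<open>0 < \<epsilon>\<close> \<epsilon> _ t,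
            where g = "\<lambda>u. Ec *v wc u"])
        (use is_solution_flow[OF x] input yk in \<open>auto simp: abs_vec_le_iff_two_sided
            intro: has_vector_derivative_at_within deriv\<close>)
    moreover have "- x t \<le> v k t"
    proof (rule flow_le_strict_supersolution[OF metzler less tendsto_minus[OF lim] _ N _ _ \<open>0 < \<epsilon>\<close> \<epsilon> _ t,
            where g = "\<lambda>u. - (Ec *v wc u)"])
      fix s t assume st: "\<tau> k < s" "s \<le> t" "t \<le> \<tau> (Suc k)"
      have "(\<lambda>u. A *v - x u + - (Ec *v wc u)) = (\<lambda>u. - (A *v x u + Ec *v wc u))"
        using matrix_vector_mult_diff_distrib[of A 0] by simp
      then show "(\<lambda>u. A *v - x u + - (Ec *v wc u)) integrable_on {s..t} \<and>
          - x t - - x s = integral {s..t} (\<lambda>u. A *v - x u + - (Ec *v wc u))"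
        using is_solution_flow[OF x st]
        by (simp add: integrable_neg integral_neg del: minus_add_distrib)
          (metis minus_diff_eq)
    qed (use input yk in \<open>auto simp: abs_vec_le_iff_two_sided
            intro: has_vector_derivative_at_within deriv\<close>)
    ultimately show ?thesis
      by (simp add: abs_vec_le_iff_two_sided)
  qed
  have "\<bar>y k\<bar> \<le> v k (\<tau> k)" for k
  proof (induction k)
    case 0
    then show ?case using init \<tau> by (simp add: y_def impulse_sequence_def)
  next
    case (Suc k)
    have "\<bar>y (Suc k)\<bar> \<le> J *v v k (\<tau> (Suc k)) + Ed *v bd"
      unfolding y_def using flow_bound[OF Suc, of "\<tau> (Suc k)"] less[of k]
      by (auto intro!: nonneg_matrix_abs_add_le nonneg wd)
    also note jump
    finally show ?case .
  qed
  then show ?thesis using flow_bound t by blast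
qed


section \<open>Stability\<close>

text \<open>
  The comparison theorem with \<open>v k t = c \<rho>\<^sup>k exp (- \<alpha> t) l\<close> and zero inputs. The initial box contains
  \<open>x0\<close> as soon as \<open>c \<ge> norm x0 / m\<close>, where \<open>m\<close> bounds the components of \<open>l\<close> from below. A strict
  supersolution needs \<open>c > 0\<close>, whereas \<open>x0 = 0\<close> would give \<open>c = 0\<close>; so all \<open>c > norm x0 / m\<close> are used, and
  the infimum over \<open>c\<close> is taken in the resulting estimate.
\<close>

lemma uniformly_exp_stable_if_strict_decrease:
  fixes A J :: "real ^ 'n ^ 'n" and Ec :: "real ^ 'p ^ 'n" and Ed :: "real ^ 'q ^ 'n"
  assumes metzler: "metzler A" and nonneg: "0 \<le> Ec" "0 \<le> J" "0 \<le> Ed"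
    and l: "\<And>i. 0 < l $ i"
    and flow: "\<And>i. (A *v l) $ i < 0" and jump: "\<And>i. (J *v l) $ i < l $ i"
  shows "uniformly_exp_stable A Ec J Ed"
proof -
  obtain r where r: "0 < r" "r < 1" "\<And>i. (J *v l) $ i + r * l $ i \<le> l $ i"
    using uniform_gap[of "\<lambda>i. (J *v l) $ i" "\<lambda>i. l $ i" "\<lambda>i. l $ i", OF jump] by blast
  \<comment> \<open>The weight \<open>l $ i + 1\<close> leaves a slack \<open>\<alpha>\<close> in addition to the decay \<open>\<alpha> * l $ i\<close>.\<close>
  obtain \<alpha> where \<alpha>: "0 < \<alpha>" "\<And>i. (A *v l) $ i + \<alpha> * (l $ i + 1) \<le> 0"
    using uniform_gap[of "\<lambda>i. (A *v l) $ i" "\<lambda>_. 0" "\<lambda>i. l $ i + 1", OF flow] by blast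
  obtain m where "0 < m" "\<And>i. 0 + m * 1 \<le> l $ i"
    using uniform_gap[of "\<lambda>_. 0" "\<lambda>i. l $ i" "\<lambda>_. 1", OF l] by blast
  then have m: "0 < m" "\<And>i. m \<le> l $ i" by simp_all
  define \<rho> where "\<rho> = 1 - r"
  have \<rho>: "0 < \<rho>" "\<rho> < 1" "\<And>i. (J *v l) $ i \<le> \<rho> * l $ i"
    using r by (auto simp: \<rho>_def algebra_simps)
  define L where "L = (\<Sum>i\<in>UNIV. l $ i)"
  have L: "0 < L" unfolding L_def by (intro sum_pos) (auto simp: l)
  have "norm (x t) \<le> L / (m * \<rho>) * \<rho> ^ num_jumps \<tau> t (\<tau> 0) * exp (- \<alpha> * (t - \<tau> 0)) * norm x0"
    if \<tau>: "impulse_sequence \<tau>" and x: "is_solution A Ec J Ed \<tau> (\<lambda>_. 0) (\<lambda>_. 0) x0 x"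
      and t: "\<tau> 0 \<le> t" for \<tau> x0 x t
  proof -
    have \<tau>0: "\<tau> 0 = 0" using \<tau> by (simp add: impulse_sequence_def)
    have c_pos: "0 < c" if "norm x0 / m < c" for c
      by (rule le_less_trans[OF _ that]) (use m(1) in simp)
    have init: "\<bar>x0\<bar> \<le> c *\<^sub>R l" if "norm x0 / m < c" for c
    proof (unfold abs_vec_le_iff, rule allI)
      fix i
      have "\<bar>x0 $ i\<bar> \<le> norm x0" by (rule component_le_norm_cart)
      also have "\<dots> \<le> c * m" using that m(1) by (simp add: field_simps)
      also have "\<dots> \<le> c * l $ i"
        using m(2) c_pos[OF that] by (intro mult_left_mono) auto
      finally show "\<bar>x0 $ i\<bar> \<le> (c *\<^sub>R l) $ i" by simp
    qed
    have bound: "\<bar>x t\<bar> \<le> (c * \<rho> ^ k * exp (- \<alpha> * t)) *\<^sub>R l"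
      if c: "norm x0 / m < c" and t: "t \<in> {\<tau> k<..\<tau> (Suc k)}" for c k t
    proof -
      have "0 < c" using c by (rule c_pos)
      define v where "v k t = (c * \<rho> ^ k * exp (- \<alpha> * t)) *\<^sub>R l" for k t
      have "\<bar>x t\<bar> \<le> v k t"
      proof (rule hybrid_abs_le_strict_supersolution[OF metzler nonneg \<tau> x negligible_empty _ _ _ _ _ _ t])
        show "\<bar>x0\<bar> \<le> v 0 0" using init[OF c] by (simp add: v_def)
        show "(v k has_vector_derivative (- \<alpha> * (c * \<rho> ^ k * exp (- \<alpha> * t))) *\<^sub>R l) (at t)" for k t
          unfolding v_def by (auto intro!: derivative_eq_intros)
        show "\<exists>\<epsilon>>0. \<forall>t\<in>{\<tau> k..\<tau> (Suc k)}. \<forall>i.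
          (A *v v k t + Ec *v 0) $ i + \<epsilon> \<le> ((- \<alpha> * (c * \<rho> ^ k * exp (- \<alpha> * t))) *\<^sub>R l) $ i" for k
        proof (intro exI conjI ballI allI)
          show "0 < c * \<rho> ^ k * exp (- \<alpha> * \<tau> (Suc k)) * \<alpha>"
            using \<open>0 < c\<close> \<rho>(1) \<alpha>(1) by simp
          fix t i assume t: "t \<in> {\<tau> k..\<tau> (Suc k)}"
          define w where "w = c * \<rho> ^ k * exp (- \<alpha> * t)"
          have w: "0 < w" "c * \<rho> ^ k * exp (- \<alpha> * \<tau> (Suc k)) \<le> w"
            using t \<open>0 < c\<close> \<rho>(1) \<alpha>(1) by (auto simp: w_def)
          have "w * ((A *v l) $ i + \<alpha> * (l $ i + 1)) \<le> 0"
            using w(1) \<alpha>(2)[of i] by (simp add: mult_le_0_iff)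
          moreover have "c * \<rho> ^ k * exp (- \<alpha> * \<tau> (Suc k)) * \<alpha> \<le> w * \<alpha>"
            using w(2) \<alpha>(1) by (intro mult_right_mono) auto
          ultimately show "(A *v v k t + Ec *v 0) $ i + c * \<rho> ^ k * exp (- \<alpha> * \<tau> (Suc k)) * \<alpha>
              \<le> ((- \<alpha> * (c * \<rho> ^ k * exp (- \<alpha> * t))) *\<^sub>R l) $ i"
            by (simp add: v_def matrix_vector_mult_scaleR w_def algebra_simps)
        qed
        show "J *v v k (\<tau> (Suc k)) + Ed *v 0 \<le> v (Suc k) (\<tau> (Suc k))" for k
          unfolding less_eq_vec_def
        proof
          fix i
          have "0 \<le> c * \<rho> ^ k * exp (- \<alpha> * \<tau> (Suc k))" using \<open>0 < c\<close> \<rho>(1) by simp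
          from mult_left_mono[OF \<rho>(3)[of i] this]
          show "(J *v v k (\<tau> (Suc k)) + Ed *v 0) $ i \<le> v (Suc k) (\<tau> (Suc k)) $ i"
            by (simp add: v_def matrix_vector_mult_scaleR algebra_simps)
        qed
      qed auto
      then show ?thesis by (simp add: v_def)
    qed
    obtain k where k: "t \<le> \<tau> (Suc k)" and
      xt: "\<And>c. norm x0 / m < c \<Longrightarrow> \<bar>x t\<bar> \<le> (c * \<rho> ^ k * exp (- \<alpha> * t)) *\<^sub>R l"
    proof (cases "t = 0")
      case True
      moreover have "x 0 = x0" using x by (simp add: is_solution_def)
      moreover have "0 \<le> \<tau> (Suc 0)"
        using \<tau> \<tau>0 unfolding impulse_sequence_def by (metis less_imp_le)
      ultimately show ?thesis using init by (intro that[of 0]) auto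
    next
      case False
      then have "0 < t" using t \<tau>0 by simp
      then obtain k where "t \<in> {\<tau> k<..\<tau> (Suc k)}" by (rule impulse_interval[OF \<tau>])
      then show ?thesis using bound by (intro that[of k]) auto
    qed
    define K where "K = \<rho> ^ k * exp (- \<alpha> * t) * L"
    have K: "0 < K" using \<rho>(1) L by (simp add: K_def)
    have "norm (x t) / K \<le> norm x0 / m"
    proof (rule dense_ge)
      fix c assume c: "norm x0 / m < c"
      have "norm (x t) \<le> (\<Sum>i\<in>UNIV. \<bar>x t $ i\<bar>)" by (rule norm_le_l1_cart)
      also have "\<dots> \<le> (\<Sum>i\<in>UNIV. c * \<rho> ^ k * exp (- \<alpha> * t) * l $ i)"
        using xt[OF c] by (intro sum_mono) (simp add: abs_vec_le_iff)
      also have "\<dots> = c * K" by (simp add: K_def L_def sum_distrib_left mult.assoc)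
      finally show "norm (x t) / K \<le> c" using K by (simp add: field_simps)
    qed
    then have "norm (x t) \<le> \<rho> ^ k * (exp (- \<alpha> * t) * L * norm x0 / m)"
      using K by (simp add: field_simps K_def)
    also have "\<rho> ^ k = \<rho> ^ Suc k / \<rho>" using \<rho>(1) by simp
    also have "\<rho> ^ Suc k / \<rho> * (exp (- \<alpha> * t) * L * norm x0 / m) \<le>
        \<rho> ^ num_jumps \<tau> t (\<tau> 0) / \<rho> * (exp (- \<alpha> * t) * L * norm x0 / m)"
      using \<rho> L m(1) num_jumps_le[OF \<tau> k]
      by (intro mult_right_mono divide_right_mono power_decreasing) auto
    finally show ?thesis by (simp add: \<tau>0 mult_ac)
  qed
  moreover have "0 < L / (m * \<rho>)" using L m(1) \<rho>(1) by simp
  ultimately show ?thesis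
    unfolding uniformly_exp_stable_def using \<rho>(1,2) \<alpha>(1) by blast
qed

section \<open>Gain\<close>

text \<open>
  The comparison theorem with the constant bound \<open>v k t = l\<close>. It confines the state for every
  \<open>t \<ge> 0\<close>, while the continuous input, and hence the continuous output, is bounded almost everywhere.
\<close>

lemma hybrid_gain_le:
  fixes A J :: "real ^ 'n ^ 'n" and Ec :: "real ^ 'p ^ 'n" and Ed :: "real ^ 'q ^ 'n"
    and Cc :: "real ^ 'n ^ 'r" and Fc :: "real ^ 'p ^ 'r"
    and Cd :: "real ^ 'n ^ 's" and Fd :: "real ^ 'q ^ 's"
  assumes pos: "positive_system A Ec J Ed Cc Fc Cd Fd" and l: "0 \<le> l"
    and flow: "\<And>i. (A *v l + Ec *v 1) $ i < 0" and jump: "J *v l + Ed *v 1 \<le> l"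
    and outc: "Cc *v l + Fc *v 1 \<le> \<gamma> *\<^sub>R 1" and outd: "Cd *v l + Fd *v 1 \<le> \<gamma> *\<^sub>R 1"
  shows "hybrid_gain A Ec J Ed Cc Fc Cd Fd \<le> ennreal \<gamma>"
  unfolding hybrid_gain_def
proof (rule Sup_least, clarify)
  fix \<tau> wc wd x
  assume \<tau>: "impulse_sequence \<tau>" and meas: "wc \<in> borel_measurable (lebesgue_on {0..})"
    and norm: "max (Linf_norm wc) (linf_norm wd) = 1"
    and x: "is_solution A Ec J Ed \<tau> wc wd 0 x"
  have nonneg: "metzler A" "0 \<le> Ec" "0 \<le> J" "0 \<le> Ed" "0 \<le> Cc" "0 \<le> Fc" "0 \<le> Cd" "0 \<le> Fd"
    using pos by (auto simp: positive_system_def)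
  have wd: "\<bar>wd k\<bar> \<le> 1" if "1 \<le> k" for k
  proof -
    have "ennreal (infnorm (wd k)) \<le> linf_norm wd"
      unfolding linf_norm_def by (rule SUP_upper) (use that in simp)
    also have "\<dots> \<le> ennreal 1" using norm by (metis ennreal_1 max.cobounded2)
    finally show ?thesis by (simp add: infnorm_le_iff)
  qed
  have wc: "AE t in lebesgue_on {0..}. \<bar>wc t\<bar> \<le> 1"
    using esssup_AE[of "\<lambda>t. ennreal (infnorm (wc t))" "lebesgue_on {0..}"]
  proof eventually_elim
    case (elim t)
    also have "esssup (lebesgue_on {0..}) (\<lambda>t. ennreal (infnorm (wc t))) \<le> ennreal 1"
      using norm by (metis ennreal_1 max.cobounded1 Linf_norm_def)
    finally show ?case by (simp add: infnorm_le_iff)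
  qed
  then have "AE t in lebesgue. t \<in> {0..} \<longrightarrow> \<bar>wc t\<bar> \<le> 1"
    by (subst (asm) AE_restrict_space_iff) auto
  then obtain N where N: "negligible N" "\<And>t. 0 \<le> t \<Longrightarrow> t \<notin> N \<Longrightarrow> \<bar>wc t\<bar> \<le> 1"
    unfolding eventually_ae_filter by (auto simp: negligible_iff_null_sets)
  have bound: "\<bar>x t\<bar> \<le> l" if "0 \<le> t" for t
  proof (cases "t = 0")
    case True
    then show ?thesis using x l by (simp add: is_solution_def)
  next
    case False
    with that have "0 < t" by simp
    then obtain k where t: "t \<in> {\<tau> k<..\<tau> (Suc k)}" by (rule impulse_interval[OF \<tau>])
    obtain \<epsilon> where \<epsilon>: "0 < \<epsilon>" "\<And>i. (A *v l + Ec *v 1) $ i + \<epsilon> * 1 \<le> 0"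
      using uniform_gap[of "\<lambda>i. (A *v l + Ec *v 1) $ i" "\<lambda>_. 0" "\<lambda>_. 1", OF flow] by blast
    show ?thesis
      by (rule hybrid_abs_le_strict_supersolution[OF nonneg(1-4) \<tau> x N(1) _ wd _ _ _ _ t,
            where v = "\<lambda>_ _. l" and v' = "\<lambda>_ _. 0"])
        (use N(2) l jump \<epsilon> in \<open>auto intro!: derivative_eq_intros exI[of _ \<epsilon>]\<close>)
  qed
  have "Linf_norm (\<lambda>t. Cc *v x t + Fc *v wc t) \<le> ennreal \<gamma>"
    unfolding Linf_norm_def
  proof (rule esssup_I)
    have "(\<lambda>t. infnorm (Cc *v x t + Fc *v wc t)) \<in> borel_measurable (lebesgue_on {0..})"
    proof (rule borel_measurable_continuous_on[where f = infnorm])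
      show "continuous_on UNIV (infnorm :: real ^ 'r \<Rightarrow> real)"
        by (intro continuous_on_infnorm continuous_on_id)
      show "(\<lambda>t. Cc *v x t + Fc *v wc t) \<in> borel_measurable (lebesgue_on {0..})"
        by (intro borel_measurable_add
            borel_measurable_continuous_on[OF linear_continuous_on[OF matrix_vector_mul_bounded_linear]]
            is_solution_measurable[OF \<tau> x] meas)
    qed
    then show "(\<lambda>t. ennreal (infnorm (Cc *v x t + Fc *v wc t))) \<in> borel_measurable (lebesgue_on {0..})"
      by simp
    show "AE t in lebesgue_on {0..}. ennreal (infnorm (Cc *v x t + Fc *v wc t)) \<le> ennreal \<gamma>"
      using wc AE_space
    proof eventually_elim
      case (elim t)
      then have "\<bar>Cc *v x t + Fc *v wc t\<bar> \<le> Cc *v l + Fc *v 1"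
        by (intro nonneg_matrix_abs_add_le nonneg bound) auto
      also note outc
      finally show ?case by (intro ennreal_leI) (simp add: infnorm_le_iff)
    qed
  qed
  moreover have "linf_norm (\<lambda>k. Cd *v x (\<tau> k) + Fd *v wd k) \<le> ennreal \<gamma>"
    unfolding linf_norm_def
  proof (rule SUP_least)
    fix k :: nat assume "k \<in> {1..}"
    then have "\<bar>Cd *v x (\<tau> k) + Fd *v wd k\<bar> \<le> Cd *v l + Fd *v 1"
      by (intro nonneg_matrix_abs_add_le nonneg bound wd impulse_time_nonneg[OF \<tau>]) auto
    also note outd
    finally show "ennreal (infnorm (Cd *v x (\<tau> k) + Fd *v wd k)) \<le> ennreal \<gamma>"
      by (intro ennreal_leI) (simp add: infnorm_le_iff)
  qed
  ultimately show "max (Linf_norm (\<lambda>t. Cc *v x t + Fc *v wc t))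
      (linf_norm (\<lambda>k. Cd *v x (\<tau> k) + Fd *v wd k)) \<le> ennreal \<gamma>"
    by simp
qed

section \<open>Stability and gain from a common vector\<close>

text \<open>
  As \<open>Ec 1\<close> and \<open>Ed 1\<close> are nonnegative, the strict inequalities with inputs imply those for the
  system without inputs, \<open>A l < 0\<close> and \<open>J l < l\<close>, on which stability rests.
\<close>

theorem theorem3p5:
  fixes A :: "real ^ 'n ^ 'n" and Ec :: "real ^ 'p ^ 'n"
    and J :: "real ^ 'n ^ 'n" and Ed :: "real ^ 'q ^ 'n"
    and Cc :: "real ^ 'n ^ 'r" and Fc :: "real ^ 'p ^ 'r"
    and Cd :: "real ^ 'n ^ 's" and Fd :: "real ^ 'q ^ 's"
    and l :: "real ^ 'n" and \<gamma> :: real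
  assumes "positive_system A Ec J Ed Cc Fc Cd Fd"
    and "\<forall>i. 0 < l $ i" and "0 < \<gamma>"
    and "\<forall>i. (A *v l + Ec *v 1) $ i < 0"
    and "\<forall>i. (Cc *v l + Fc *v 1 - \<gamma> *\<^sub>R 1) $ i < 0"
    and "\<forall>i. ((J - mat 1) *v l + Ed *v 1) $ i < 0"
    and "\<forall>i. (Cd *v l + Fd *v 1 - \<gamma> *\<^sub>R 1) $ i < 0"
  shows "uniformly_exp_stable A Ec J Ed
    \<and> hybrid_gain A Ec J Ed Cc Fc Cd Fd \<le> ennreal \<gamma>"
proof
  have nonneg: "metzler A" "0 \<le> Ec" "0 \<le> J" "0 \<le> Ed"
    using assms(1) by (auto simp: positive_system_def)
  have input: "0 \<le> (Ec *v 1) $ i" "0 \<le> (Ed *v 1) $ i" for i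
    using nonneg(2,4)
    by (auto simp: matrix_vector_mult_def less_eq_vec_def intro!: sum_nonneg)
  have jump: "(J *v l + Ed *v 1) $ i < l $ i" for i
    using assms(6)[rule_format, of i] by (simp add: matrix_vector_mult_diff_rdistrib)
  have "(A *v l) $ i < 0" "(J *v l) $ i < l $ i" for i
    using assms(4)[rule_format, of i] jump[of i] input[of i] by simp_all
  then show "uniformly_exp_stable A Ec J Ed"
    using assms(2) by (intro uniformly_exp_stable_if_strict_decrease[OF nonneg, of l]) auto
  show "hybrid_gain A Ec J Ed Cc Fc Cd Fd \<le> ennreal \<gamma>"
  proof (rule hybrid_gain_le[OF assms(1), of l])
    show "J *v l + Ed *v 1 \<le> l" using jump by (simp add: less_eq_vec_def less_imp_le)
    show "Cc *v l + Fc *v 1 \<le> \<gamma> *\<^sub>R 1" using assms(5) by (simp add: less_eq_vec_def less_imp_le)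
    show "Cd *v l + Fd *v 1 \<le> \<gamma> *\<^sub>R 1" using assms(7) by (simp add: less_eq_vec_def less_imp_le)
  qed (use assms(2,4) in \<open>auto simp: less_eq_vec_def less_imp_le\<close>)
qed

end
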